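(* Let $n \geq 2$ be an integer, let $N := n-\frac{1}{24}$, and let $j$ be a positive integer with $j \leq \frac{\sqrt{N}}{4}$. Then \[ p(n) - 2p(n-j) + p(n-2j) \geq 0, \] equivalently $p(n) + p(n-2j) \geq 2p(n-j)$.
   Context: $p(m)$ denotes the number of partitions of the nonnegative integer $m$ (with $p(0)=1$). *)

theory Defs
  imports Complex_Main "HOL-Library.Multiset"
begin

definition partitions :: "nat \<Rightarrow> nat multiset set" where
  "partitions m = {P. (\<forall>k\<in>#P. 0 < k) \<and> sum_mset P = m}"

definition part_num :: "nat \<Rightarrow> nat" where
  "part_num m = card (partitions m)"

text \<open>Ensures that \<open>card\<close> in the definition of \<open>part_num\<close> is a genuine count.\<close>

lemma finite_partitions: "finite (partitions m)"
proof -
  have "partitions m \<subseteq> mset ` {xs. set xs \<subseteq> {..m} \<and> length xs \<le> m}"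
  proof
    fix P assume "P \<in> partitions m"
    then have pos: "\<forall>k\<in>#P. 0 < k" and s: "sum_mset P = m"
      by (auto simp: partitions_def)
    obtain xs where xs: "P = mset xs"
      by (metis ex_mset)
    have "\<forall>k\<in>set xs. 0 < k" "sum_list xs = m"
      using pos s xs by (auto simp: sum_mset_sum_list)
    moreover have "length ys \<le> sum_list ys" if "\<forall>k\<in>set ys. 0 < k" for ys :: "nat list"
      using that by (induction ys) auto
    ultimately have "length xs \<le> m" "set xs \<subseteq> {..m}"
      by (auto dest: member_le_sum_list)
    then show "P \<in> mset ` {xs. set xs \<subseteq> {..m} \<and> length xs \<le> m}"
      using xs by blast
  qed
  then show ?thesis
    by (rule finite_subset) (intro finite_imageI finite_lists_length_le, simp)
qed

lemma part_num_0: "part_num 0 = 1"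
proof -
  have "partitions 0 = {{#}}"
    by (auto simp: partitions_def) (metis less_numeral_extra(3) multiset_nonemptyE)
  then show ?thesis
    by (simp add: part_num_def)
qed

end

theory Submission
  imports Defs
begin

text \<open>
  Partitions of \<open>m + j\<close> containing the part \<open>j\<close> correspond to partitions of \<open>m\<close>, so
  \<open>p (m + j) - p m\<close> counts the partitions of \<open>m + j\<close> without the part \<open>j\<close>, and the second
  difference is nonnegative as soon as partitions of \<open>m\<close> without the part \<open>j\<close> inject into
  those of \<open>m + j\<close>. For \<open>j \<ge> 2\<close>, append \<open>j\<close> ones; for \<open>j = 1\<close> and \<open>m > 0\<close>,
  increase the largest part by one.
\<close>

definition partitions_avoiding :: "nat \<Rightarrow> nat \<Rightarrow> nat multiset set" where
  "partitions_avoiding j m = {P \<in> partitions m. j \<notin># P}"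

lemma finite_partitions_avoiding: "finite (partitions_avoiding j m)"
  by (simp add: partitions_avoiding_def finite_partitions)

lemma part_num_add:
  assumes "j > 0"
  shows "part_num (m + j) = part_num m + card (partitions_avoiding j (m + j))"
proof -
  have split: "partitions (m + j) = add_mset j ` partitions m \<union> partitions_avoiding j (m + j)"
  proof (intro equalityI subsetI)
    fix P assume P: "P \<in> partitions (m + j)"
    show "P \<in> add_mset j ` partitions m \<union> partitions_avoiding j (m + j)"
    proof (cases "j \<in># P")
      case True
      then obtain Q where "P = add_mset j Q"
        by (metis insert_DiffM)
      with P show ?thesis
        by (auto simp: partitions_def)
    next
      case False
      with P show ?thesis
        by (simp add: partitions_avoiding_def)
    qed
  qed (use assms in \<open>auto simp: partitions_def partitions_avoiding_def\<close>)
  have "card (partitions (m + j)) =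
      card (add_mset j ` partitions m) + card (partitions_avoiding j (m + j))"
    unfolding split
    by (rule card_Un_disjoint)
      (auto simp: finite_partitions finite_partitions_avoiding, auto simp: partitions_avoiding_def)
  also have "card (add_mset j ` partitions m) = card (partitions m)"
    by (rule card_image) (simp add: inj_on_def)
  finally show ?thesis
    by (simp add: part_num_def)
qed

text \<open>Adding a fixed multiset of ones is injective by cancellation, and since \<open>j\<close>
  is not 1 the new parts do not bring in the forbidden one.\<close>

lemma card_partitions_avoiding_mono:
  assumes "j \<ge> 2"
  shows "card (partitions_avoiding j m) \<le> card (partitions_avoiding j (m + j))"
proof (rule card_inj_on_le)
  show "inj_on (\<lambda>P. P + replicate_mset j 1) (partitions_avoiding j m)"
    by (simp add: inj_on_def)
  show "(\<lambda>P. P + replicate_mset j 1) ` partitions_avoiding j m \<subseteq> partitions_avoiding j (m + j)"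
    using assms by (auto simp: partitions_avoiding_def partitions_def)
qed (rule finite_partitions_avoiding)

text \<open>Appending a one is forbidden here, so the largest part grows instead. Positivity of
  \<open>m\<close> guarantees that there is a part to enlarge; at \<open>m = 0\<close> the counts
  are 1 and 0.\<close>

lemma card_partitions_avoiding_1_mono:
  assumes "m > 0"
  shows "card (partitions_avoiding 1 m) \<le> card (partitions_avoiding 1 (m + 1))"
proof (rule card_inj_on_le)
  define f :: "nat multiset \<Rightarrow> nat multiset"
    where "f P = add_mset (Suc (Max_mset P)) (P - {#Max_mset P#})" for P
  have Max_in: "Max_mset P \<in># P" if "P \<in> partitions_avoiding 1 m" for P
    using that assms by (intro Max_in) (auto simp: partitions_avoiding_def partitions_def)
  \<comment> \<open>The enlarged part is still the largest, so \<open>f P\<close> reveals which part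
    was changed and \<open>f\<close> can be undone.\<close>
  have Max_f: "Max_mset (f P) = Suc (Max_mset P)" for P
    unfolding f_def
    by (rule Max_eqI) (auto dest!: in_diffD intro: le_SucI)
  show "inj_on f (partitions_avoiding 1 m)"
  proof (rule inj_onI)
    fix P Q
    assume P: "P \<in> partitions_avoiding 1 m" and Q: "Q \<in> partitions_avoiding 1 m"
      and eq: "f P = f Q"
    from Max_f[of P] Max_f[of Q] eq have "Max_mset P = Max_mset Q"
      by simp
    with eq have "P - {#Max_mset P#} = Q - {#Max_mset P#}"
      by (simp add: f_def)
    then show "P = Q"
      using Max_in[OF P] Max_in[OF Q] \<open>Max_mset P = Max_mset Q\<close>
      by (metis insert_DiffM)
  qed
  show "f ` partitions_avoiding 1 m \<subseteq> partitions_avoiding 1 (m + 1)"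
  proof
    fix R assume "R \<in> f ` partitions_avoiding 1 m"
    then obtain P where P: "P \<in> partitions_avoiding 1 m" and R: "R = f P"
      by blast
    define M where "M = Max_mset P"
    define Q where "Q = P - {#M#}"
    have "P = add_mset M Q"
      using Max_in[OF P] by (simp add: M_def Q_def)
    moreover have "R = add_mset (Suc M) Q"
      by (simp add: R f_def M_def Q_def)
    \<comment> \<open>As a part of \<open>P\<close>, \<open>M\<close> is positive, so the new part
      \<open>Suc M\<close> differs from 1.\<close>
    ultimately show "R \<in> partitions_avoiding 1 (m + 1)"
      using P by (auto simp: partitions_avoiding_def partitions_def)
  qed
qed (rule finite_partitions_avoiding)

lemma part_num_convex:
  assumes "j > 0"
  shows "2 * part_num (m + j) \<le> part_num (m + 2 * j) + part_num m"
proof -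
  have "card (partitions_avoiding j (m + j)) \<le> card (partitions_avoiding j (m + j + j))"
  proof (cases "j = 1")
    case True
    with assms show ?thesis
      \<comment> \<open>The total being partitioned is \<open>m + 1\<close>, which is positive even
        for \<open>m = 0\<close>.\<close>
      using card_partitions_avoiding_1_mono[of "m + 1"] by simp
  next
    case False
    with assms show ?thesis
      by (intro card_partitions_avoiding_mono) simp
  qed
  \<comment> \<open>The two cardinalities are the consecutive differences p(m+j) - p(m) and p(m+2j)
    - p(m+j).\<close>
  then show ?thesis
    using part_num_add[of j m] part_num_add[of j "m + j"] assms
    by (simp add: mult_2 add.assoc)
qed

theorem theorem1p2:
  fixes n j :: nat
    and N :: real
  assumes "n \<ge> 2"
    and "N = real n - 1 / 24"
    and "j > 0"
    and "real j \<le> sqrt N / 4"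
  shows "int (part_num n) - 2 * int (part_num (n - j)) + int (part_num (n - 2 * j)) \<ge> 0
       \<and> part_num n + part_num (n - 2 * j) \<ge> 2 * part_num (n - j)"
proof -
  \<comment> \<open>Squaring the bound on \<open>j\<close> leads to \<open>2 * j \<le> n\<close>, so
    the natural-number subtractions in the goal are not truncated.\<close>
  have "(4 * real j)\<^sup>2 \<le> (sqrt N)\<^sup>2"
    using assms(4) by (intro power_mono) auto
  also have "(sqrt N)\<^sup>2 = N"
    using assms(1,2) by simp
  also have "N \<le> real n"
    using assms(2) by simp
  finally have "real (16 * (j * j)) \<le> real n"
    by (simp add: power2_eq_square)
  then have "16 * (j * j) \<le> n"
    by (simp only: of_nat_le_iff)
  moreover have "j \<le> j * j"
    by simp
  ultimately have "2 * j \<le> n"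
    by linarith
  then obtain m where n: "n = m + 2 * j"
    by (metis le_add_diff_inverse2)
  have "n - j = m + j" "n - 2 * j = m"
    using n by simp_all
  with part_num_convex[of j m] assms(3) n show ?thesis
    by (simp add: add.commute)
qed

end
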